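(* Let $U = \langle \iota \mapsto I_\iota\rangle^{\iota \in [1..n]}$ be a program, $\sigma$ and $\tau$ finite configurations, $\sigma_{\infty}$ and $\tau_{\infty}$ infinite configurations, and let $h \in [1..n]$. Then the following properties hold: (1) $cp_+(U,\sigma,h,\tau) \land \sigma \models U \land \sigma \subset \sigma_{\infty} \land \tau \subset \tau_{\infty} \Rightarrow cp_+(U,\sigma_{\infty},h,\tau_{\infty})$; (2) $cp_{\infty}(U,\sigma,h) \land \sigma \models U \land \sigma \subset \sigma_{\infty} \Rightarrow cp_{\infty}(U,\sigma_{\infty},h)$; (3) $cp_+(U,\sigma_{\infty},h,\tau_{\infty}) \Rightarrow cp_+(U,\sigma_{\infty | U},h,\tau_{\infty | U})$; (4) $cp_{\infty}(U,\sigma_{\infty},h) \Rightarrow cp_{\infty}(U,\sigma_{\infty | U},h)$.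
   Context: Setting: the Unlimited Register Machine (URM, Cutland's formulation) formalized in the Calculus of (Co)Inductive Constructions ($\text{CC}^\text{(Co)Ind}$). Instructions: $Z(i)$ ($0 \to R_i$), $S(i)$ ($r_i+1 \to R_i$), $T(i,j)$ ($r_i \to R_j$), $J(i,j,k)$ (if $r_i = r_j$ proceed from the $k$th instruction, else from the next). A program $U = \langle \iota \mapsto I_\iota\rangle^{\iota \in [1..n]}$ is in standard form if every $J(i,j,k) \in U$ has $k \leq n$ (jump target $0$ means halting). A finite (list) configuration is $\sigma = (\iota \mapsto s_\iota)^{\iota \in [1..m]}$; an infinite (stream) configuration is $\tau_{\infty} = (\iota \mapsto t_\iota)^{\iota \in [1..\infty)}$. Compatibility $\sigma \models U$: $U$ is in standard form and for every $Z(i), S(i), T(i,j), J(i,j,k) \in U$, $i,j \in [1..m]$. Inclusion: $\sigma \subset \tau_{\infty}$ iff $t_\iota = s_\iota$ for all $\iota \in [1..m]$ and $t_\iota = 0$ for all $\iota > m$. Restriction: $\tau_{\infty | U} = (\iota \mapsto t_\iota)^{\iota \in [1..\rho(U)]}$, where $\rho(U)$ is the maximal register index affected by the instructions of $U$. Evaluation (for $h \in [1..n]$, $r_i$ the content of $R_i$ in the current configuration): $cp_+(U,\sigma,h,\tau)$ (computation from the $h$th instruction stops, turning $\sigma$ into $\tau$) is defined inductively by: if $I_h = J(i,j,k)$: ($h = n$, $r_i \neq r_j$) gives $cp_+(U,\sigma,h,\sigma)$; ($h<n$, $r_i \neq r_j$, $cp_+(U,\sigma,h+1,\tau)$) gives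 $cp_+(U,\sigma,h,\tau)$; ($k=0$, $r_i = r_j$) gives $cp_+(U,\sigma,h,\sigma)$; ($k \neq 0$, $r_i = r_j$, $cp_+(U,\sigma,k,\tau)$) gives $cp_+(U,\sigma,h,\tau)$. If $I_h$ is $Z(i)$, $S(i)$ or $T(i,j)$, let $f(\sigma)$ be respectively $zr(\sigma,i)$ (set $R_i$ to $0$), $sc(\sigma,i)$ (increment $R_i$), $mv(\sigma,i,j)$ (copy $r_i$ into $R_j$): ($h=n$) gives $cp_+(U,\sigma,h,f(\sigma))$; ($h<n$, $cp_+(U,f(\sigma),h+1,\tau)$) gives $cp_+(U,\sigma,h,\tau)$. $cp_{\infty}(U,\sigma,h)$ (computation from the $h$th instruction diverges) is defined coinductively by: for $I_h = J(i,j,k)$: ($h<n$, $r_i \neq r_j$, $cp_{\infty}(U,\sigma,h+1)$) gives $cp_{\infty}(U,\sigma,h)$; ($k\neq 0$, $r_i = r_j$, $cp_{\infty}(U,\sigma,k)$) gives $cp_{\infty}(U,\sigma,h)$; for $Z$, $S$, $T$: ($h<n$, $cp_{\infty}(U,f(\sigma),h+1)$) gives $cp_{\infty}(U,\sigma,h)$. These rules are given for infinite configurations; $cp_+$ and $cp_\infty$ are overloaded with a second definition on finite configurations using the same rules plus the extra compatibility constraint between the finite configuration and the program.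
   Formalization: Parts (3) and (4) additionally assume that U is in standard form; otherwise no finite configuration is compatible with U and they fail, e.g. (3) for U = ⟨J(1,2,7)⟩ with r_1 ≠ r_2, h = 1, and (4) for U = ⟨J(1,1,1), J(1,1,7)⟩, h = 1. *)

theory Defs
  imports Main "HOL-Library.Stream"
begin

text \<open>Registers \<open>R\<^sub>1, R\<^sub>2, \<dots>\<close> and instructions are numbered from 1, whereas \<open>!\<close> and \<open>!!\<close>
  index from 0. The jump target 0 means halting.\<close>

datatype instr =
    Zero nat
  | Succ nat
  | Transfer nat nat
  | Jump nat nat nat

type_synonym program = "instr list"

text \<open>\<open>instr_at U h I\<close> is false for \<open>h\<close> outside \<open>[1..n]\<close>, so no evaluation rule below applies there.\<close>

definition instr_at :: "program \<Rightarrow> nat \<Rightarrow> instr \<Rightarrow> bool" where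
  "instr_at U h I \<longleftrightarrow> h \<in> {1..length U} \<and> U ! (h - 1) = I"

fun regs :: "instr \<Rightarrow> nat set" where
  "regs (Zero i) = {i}"
| "regs (Succ i) = {i}"
| "regs (Transfer i j) = {i, j}"
| "regs (Jump i j k) = {i, j}"

text \<open>There is no register \<open>R\<^sub>0\<close>, but the index type \<open>nat\<close> does not exclude it.\<close>

definition wf_program :: "program \<Rightarrow> bool" where
  "wf_program U \<longleftrightarrow> (\<forall>I \<in> set U. \<forall>i \<in> regs I. 1 \<le> i)"

definition standard_form :: "program \<Rightarrow> bool" where
  "standard_form U \<longleftrightarrow> (\<forall>i j k. Jump i j k \<in> set U \<longrightarrow> k \<le> length U)"

text \<open>The registers compared by a jump count as affected: otherwise the restriction of a stream
  to \<open>[1..rho U]\<close> need not be compatible with \<open>U\<close>.\<close>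

definition rho :: "program \<Rightarrow> nat" where
  "rho U = Max (\<Union>I \<in> set U. regs I)"


type_synonym fconf = "nat list"
type_synonym iconf = "nat stream"

definition compatible :: "fconf \<Rightarrow> program \<Rightarrow> bool" where
  "compatible \<sigma> U \<longleftrightarrow>
     standard_form U \<and> (\<forall>I \<in> set U. \<forall>i \<in> regs I. i \<in> {1..length \<sigma>})"

definition freg :: "fconf \<Rightarrow> nat \<Rightarrow> nat" where
  "freg \<sigma> i = \<sigma> ! (i - 1)"

definition fset :: "fconf \<Rightarrow> nat \<Rightarrow> nat \<Rightarrow> fconf" where
  "fset \<sigma> i v = \<sigma>[i - 1 := v]"

definition ireg :: "iconf \<Rightarrow> nat \<Rightarrow> nat" where
  "ireg \<sigma> i = \<sigma> !! (i - 1)"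

definition iset :: "iconf \<Rightarrow> nat \<Rightarrow> nat \<Rightarrow> iconf" where
  "iset \<sigma> i v = stake (i - 1) \<sigma> @- v ## sdrop (Suc (i - 1)) \<sigma>"

definition included :: "fconf \<Rightarrow> iconf \<Rightarrow> bool" where
  "included \<sigma> \<tau> \<longleftrightarrow>
     (\<forall>i \<in> {1..length \<sigma>}. ireg \<tau> i = freg \<sigma> i) \<and> (\<forall>i > length \<sigma>. ireg \<tau> i = 0)"

definition restrict_conf :: "iconf \<Rightarrow> program \<Rightarrow> fconf" where
  "restrict_conf \<tau> U = map (ireg \<tau>) [1..<Suc (rho U)]"


text \<open>\<open>f_effect\<close> and \<open>i_effect\<close> give \<open>f(\<sigma>)\<close> for the non-jump instructions: \<open>zr(\<sigma>,i)\<close>,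
  \<open>sc(\<sigma>,i)\<close> and \<open>mv(\<sigma>,i,j)\<close>. Their value on jumps is never used.\<close>

fun is_jump :: "instr \<Rightarrow> bool" where
  "is_jump (Jump i j k) = True"
| "is_jump _ = False"

fun f_effect :: "instr \<Rightarrow> fconf \<Rightarrow> fconf" where
  "f_effect (Zero i) \<sigma> = fset \<sigma> i 0"
| "f_effect (Succ i) \<sigma> = fset \<sigma> i (freg \<sigma> i + 1)"
| "f_effect (Transfer i j) \<sigma> = fset \<sigma> j (freg \<sigma> i)"
| "f_effect (Jump i j k) \<sigma> = \<sigma>"

fun i_effect :: "instr \<Rightarrow> iconf \<Rightarrow> iconf" where
  "i_effect (Zero i) \<sigma> = iset \<sigma> i 0"
| "i_effect (Succ i) \<sigma> = iset \<sigma> i (ireg \<sigma> i + 1)"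
| "i_effect (Transfer i j) \<sigma> = iset \<sigma> j (ireg \<sigma> i)"
| "i_effect (Jump i j k) \<sigma> = \<sigma>"


inductive i_conv :: "program \<Rightarrow> iconf \<Rightarrow> nat \<Rightarrow> iconf \<Rightarrow> bool" for U where
  i_conv_jump_end:
    "\<lbrakk>instr_at U h (Jump i j k); h = length U; ireg \<sigma> i \<noteq> ireg \<sigma> j\<rbrakk> \<Longrightarrow> i_conv U \<sigma> h \<sigma>"
| i_conv_jump_next:
    "\<lbrakk>instr_at U h (Jump i j k); h < length U; ireg \<sigma> i \<noteq> ireg \<sigma> j; i_conv U \<sigma> (h + 1) \<tau>\<rbrakk>
     \<Longrightarrow> i_conv U \<sigma> h \<tau>"
| i_conv_jump_halt:
    "\<lbrakk>instr_at U h (Jump i j k); k = 0; ireg \<sigma> i = ireg \<sigma> j\<rbrakk> \<Longrightarrow> i_conv U \<sigma> h \<sigma>"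
| i_conv_jump_to:
    "\<lbrakk>instr_at U h (Jump i j k); k \<noteq> 0; ireg \<sigma> i = ireg \<sigma> j; i_conv U \<sigma> k \<tau>\<rbrakk>
     \<Longrightarrow> i_conv U \<sigma> h \<tau>"
| i_conv_step_end:
    "\<lbrakk>instr_at U h I; \<not> is_jump I; h = length U\<rbrakk> \<Longrightarrow> i_conv U \<sigma> h (i_effect I \<sigma>)"
| i_conv_step_next:
    "\<lbrakk>instr_at U h I; \<not> is_jump I; h < length U; i_conv U (i_effect I \<sigma>) (h + 1) \<tau>\<rbrakk>
     \<Longrightarrow> i_conv U \<sigma> h \<tau>"

coinductive i_div :: "program \<Rightarrow> iconf \<Rightarrow> nat \<Rightarrow> bool" for U where
  i_div_jump_next:
    "\<lbrakk>instr_at U h (Jump i j k); h < length U; ireg \<sigma> i \<noteq> ireg \<sigma> j; i_div U \<sigma> (h + 1)\<rbrakk>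
     \<Longrightarrow> i_div U \<sigma> h"
| i_div_jump_to:
    "\<lbrakk>instr_at U h (Jump i j k); k \<noteq> 0; ireg \<sigma> i = ireg \<sigma> j; i_div U \<sigma> k\<rbrakk>
     \<Longrightarrow> i_div U \<sigma> h"
| i_div_step_next:
    "\<lbrakk>instr_at U h I; \<not> is_jump I; h < length U; i_div U (i_effect I \<sigma>) (h + 1)\<rbrakk>
     \<Longrightarrow> i_div U \<sigma> h"

text \<open>On finite configurations: the same rules, each with the compatibility constraint added.\<close>

inductive f_conv :: "program \<Rightarrow> fconf \<Rightarrow> nat \<Rightarrow> fconf \<Rightarrow> bool" for U where
  f_conv_jump_end:
    "\<lbrakk>compatible \<sigma> U; instr_at U h (Jump i j k); h = length U; freg \<sigma> i \<noteq> freg \<sigma> j\<rbrakk>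
     \<Longrightarrow> f_conv U \<sigma> h \<sigma>"
| f_conv_jump_next:
    "\<lbrakk>compatible \<sigma> U; instr_at U h (Jump i j k); h < length U; freg \<sigma> i \<noteq> freg \<sigma> j;
      f_conv U \<sigma> (h + 1) \<tau>\<rbrakk> \<Longrightarrow> f_conv U \<sigma> h \<tau>"
| f_conv_jump_halt:
    "\<lbrakk>compatible \<sigma> U; instr_at U h (Jump i j k); k = 0; freg \<sigma> i = freg \<sigma> j\<rbrakk>
     \<Longrightarrow> f_conv U \<sigma> h \<sigma>"
| f_conv_jump_to:
    "\<lbrakk>compatible \<sigma> U; instr_at U h (Jump i j k); k \<noteq> 0; freg \<sigma> i = freg \<sigma> j;
      f_conv U \<sigma> k \<tau>\<rbrakk> \<Longrightarrow> f_conv U \<sigma> h \<tau>"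
| f_conv_step_end:
    "\<lbrakk>compatible \<sigma> U; instr_at U h I; \<not> is_jump I; h = length U\<rbrakk>
     \<Longrightarrow> f_conv U \<sigma> h (f_effect I \<sigma>)"
| f_conv_step_next:
    "\<lbrakk>compatible \<sigma> U; instr_at U h I; \<not> is_jump I; h < length U;
      f_conv U (f_effect I \<sigma>) (h + 1) \<tau>\<rbrakk> \<Longrightarrow> f_conv U \<sigma> h \<tau>"

coinductive f_div :: "program \<Rightarrow> fconf \<Rightarrow> nat \<Rightarrow> bool" for U where
  f_div_jump_next:
    "\<lbrakk>compatible \<sigma> U; instr_at U h (Jump i j k); h < length U; freg \<sigma> i \<noteq> freg \<sigma> j;
      f_div U \<sigma> (h + 1)\<rbrakk> \<Longrightarrow> f_div U \<sigma> h"
| f_div_jump_to: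
    "\<lbrakk>compatible \<sigma> U; instr_at U h (Jump i j k); k \<noteq> 0; freg \<sigma> i = freg \<sigma> j; f_div U \<sigma> k\<rbrakk>
     \<Longrightarrow> f_div U \<sigma> h"
| f_div_step_next:
    "\<lbrakk>compatible \<sigma> U; instr_at U h I; \<not> is_jump I; h < length U;
      f_div U (f_effect I \<sigma>) (h + 1)\<rbrakk> \<Longrightarrow> f_div U \<sigma> h"

end

theory Submission
  imports Defs
begin

text \<open>One step of the machine commutes both with extending a compatible finite configuration by zeros
  and with restricting a stream to the registers occurring in the program, and the jump tests agree,
  so a derivation on one side is transferred rule by rule. The zero tail makes the extension unique,
  hence a halting configuration extends to the prescribed stream.\<close>

lemma instr_at_in_set: "instr_at U h I \<Longrightarrow> I \<in> set U"
  by (auto simp: instr_at_def)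

text \<open>Truncated subtraction sends index 0 to the cell of register 1, so positivity is what
  makes distinct indices name distinct cells.\<close>

lemma ireg_iset:
  assumes "1 \<le> i" "1 \<le> j"
  shows "ireg (iset s i v) j = (if i = j then v else ireg s j)"
proof -
  obtain a b where "i = Suc a" "j = Suc b"
    using assms by (metis Suc_le_D One_nat_def)
  \<comment> \<open>Past the \<open>a\<close> cells of \<open>stake a s\<close>, position
    \<open>b\<close> is looked up at \<open>b - a\<close>; the head \<open>v\<close> stands in for
    the dropped cell \<open>a\<close>, so no shift results.\<close>
  moreover have "(v ## sdrop (Suc a) s) !! (b - a) = s !! b" if "a < b"
    using that by (simp add: sdrop_snth Suc_diff_Suc[symmetric] del: sdrop.simps)
  ultimately show ?thesis
    by (auto simp: ireg_def iset_def shift_snth not_less le_less simp del: sdrop.simps)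
qed

lemma length_fset [simp]: "length (fset \<sigma> i v) = length \<sigma>"
  by (simp add: fset_def)

lemma freg_fset:
  assumes "i \<in> {1..length \<sigma>}" "1 \<le> j"
  shows "freg (fset \<sigma> i v) j = (if i = j then v else freg \<sigma> j)"
proof -
  have "i - 1 = j - 1 \<longleftrightarrow> i = j" "i - 1 < length \<sigma>"
    using assms by auto
  then show ?thesis
    by (simp add: freg_def fset_def nth_list_update)
qed

lemma compatible_regs:
  "compatible \<sigma> U \<Longrightarrow> instr_at U h I \<Longrightarrow> regs I \<subseteq> {1..length \<sigma>}"
  by (auto simp: compatible_def dest!: instr_at_in_set)

lemma included_unique:
  assumes "included \<sigma> s" "included \<sigma> t"
  shows "s = t"
proof -
  have "ireg s i = ireg t i" if "1 \<le> i" for i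
    using assms that by (cases "i \<le> length \<sigma>") (auto simp: included_def)
  from this[of "Suc _"] have "(!!) s = (!!) t"
    by (simp add: ireg_def fun_eq_iff)
  then show ?thesis
    \<comment> \<open>Any stream is the image of \<open>nats\<close> under its own indexing
      function, hence is determined by that function.\<close>
    by (metis stream_smap_nats)
qed

lemma included_ireg: "included \<sigma> s \<Longrightarrow> i \<in> {1..length \<sigma>} \<Longrightarrow> ireg s i = freg \<sigma> i"
  by (simp add: included_def)

text \<open>Register \<open>i\<close> lies within the list, so the zero tail of \<open>s\<close> is
  untouched.\<close>

lemma included_iset:
  assumes "included \<sigma> s" "i \<in> {1..length \<sigma>}"
  shows "included (fset \<sigma> i v) (iset s i v)"
  using assms by (auto simp: included_def ireg_iset freg_fset)

lemma included_effect:
  assumes "included \<sigma> s" "regs I \<subseteq> {1..length \<sigma>}"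
  shows "included (f_effect I \<sigma>) (i_effect I s)"
  using assms by (cases I) (simp_all add: included_ireg included_iset)

lemma jump_test_included:
  assumes "included \<sigma> s" "compatible \<sigma> U" "instr_at U h (Jump i j k)"
  shows "ireg s i = ireg s j \<longleftrightarrow> freg \<sigma> i = freg \<sigma> j"
  using compatible_regs[OF assms(2,3)] assms(1) by (simp add: included_ireg)

lemma i_conv_of_f_conv:
  assumes "f_conv U \<sigma> h \<tau>" "included \<sigma> s" "included \<tau> t"
  shows "i_conv U s h t"
  using assms
\<comment> \<open>The current stream changes along the run, while the final stream \<open>t\<close>
  is common to all steps.\<close>
proof (induction arbitrary: s)
  case (f_conv_jump_end \<sigma> h i j k)
  moreover from this have "s = t"
    using included_unique by blast
  ultimately show ?case
    by (metis i_conv_jump_end jump_test_included)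
next
  case (f_conv_jump_next \<sigma> h i j k \<tau>)
  then show ?case
    by (metis i_conv_jump_next jump_test_included)
next
  case (f_conv_jump_halt \<sigma> h i j k)
  moreover from this have "s = t"
    using included_unique by blast
  ultimately show ?case
    by (metis i_conv_jump_halt jump_test_included)
next
  case (f_conv_jump_to \<sigma> h i j k \<tau>)
  then show ?case
    by (metis i_conv_jump_to jump_test_included)
next
  case (f_conv_step_end \<sigma> h I)
  then have "i_effect I s = t"
    by (meson compatible_regs included_effect included_unique)
  with f_conv_step_end show ?case
    using i_conv_step_end by blast
next
  case (f_conv_step_next \<sigma> h I \<tau>)
  then show ?case
    by (meson compatible_regs i_conv_step_next included_effect)
qed

lemma i_div_of_f_div:
  assumes "f_div U \<sigma> h" "included \<sigma> s"
  shows "i_div U s h"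
proof -
  \<comment> \<open>The coinduction invariant on \<open>s\<close> and \<open>h\<close>: some finite
    configuration included in \<open>s\<close> diverges from \<open>h\<close>.\<close>
  from assms have "\<exists>\<sigma>. f_div U \<sigma> h \<and> included \<sigma> s"
    by blast
  then show ?thesis
  proof (coinduction arbitrary: s h)
    case i_div
    then obtain \<sigma> where "f_div U \<sigma> h" and incl: "included \<sigma> s"
      by blast
    then show ?case
    proof cases
      case (f_div_jump_next i j k)
      then show ?thesis
        using incl jump_test_included[OF incl f_div_jump_next(1,2)] by (intro disjI1) auto
    next
      case (f_div_jump_to i j k)
      then show ?thesis
        using incl jump_test_included[OF incl f_div_jump_to(1,2)] by (intro disjI2 disjI1) auto
    next
      case (f_div_step_next I)
      \<comment> \<open>The invariant is re-established for \<open>i_effect I s\<close> with the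
        finite witness \<open>f_effect I \<sigma>\<close>.\<close>
      then show ?thesis
        using included_effect[OF incl compatible_regs[OF f_div_step_next(1,2)]]
        by (intro disjI2) auto
    qed
  qed
qed

lemma regs_le_rho:
  assumes "wf_program U" "I \<in> set U"
  shows "regs I \<subseteq> {1..rho U}"
proof
  fix i assume "i \<in> regs I"
  \<comment> \<open>\<open>Max\<close> is known to bound its members only for a finite set; here it
    is a finite union of finite sets.\<close>
  moreover have "finite (regs J)" for J
    by (cases J) auto
  ultimately have "i \<le> rho U"
    using assms(2) unfolding rho_def by (intro Max_ge) auto
  then show "i \<in> {1..rho U}"
    using assms \<open>i \<in> regs I\<close> by (auto simp: wf_program_def)
qed

lemma length_restrict_conf [simp]: "length (restrict_conf s U) = rho U"
  by (simp add: restrict_conf_def)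

lemma freg_restrict_conf: "i \<in> {1..rho U} \<Longrightarrow> freg (restrict_conf s U) i = ireg s i"
  by (auto simp: freg_def restrict_conf_def nth_append simp del: upt_Suc)

text \<open>Since \<open>rho\<close> also counts the registers compared by jumps, the restriction is
  long enough for every instruction. This discharges the constraint attached to each finite
  rule.\<close>

lemma compatible_restrict_conf:
  "wf_program U \<Longrightarrow> standard_form U \<Longrightarrow> compatible (restrict_conf s U) U"
  using regs_le_rho by (fastforce simp: compatible_def)

lemma restrict_conf_iset:
  assumes "i \<in> {1..rho U}"
  shows "restrict_conf (iset s i v) U = fset (restrict_conf s U) i v"
proof (rule nth_equalityI)
  fix n assume "n < length (restrict_conf (iset s i v) U)"
  \<comment> \<open>List position \<open>n\<close> holds register \<open>Suc n\<close>.\<close>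
  then have "Suc n \<in> {1..rho U}"
    by simp
  then have "freg (restrict_conf (iset s i v) U) (Suc n)
      = freg (fset (restrict_conf s U) i v) (Suc n)"
    using assms by (simp add: freg_restrict_conf ireg_iset freg_fset del: One_nat_def)
  then show "restrict_conf (iset s i v) U ! n = fset (restrict_conf s U) i v ! n"
    by (simp add: freg_def)
qed simp

lemma restrict_conf_i_effect:
  "regs I \<subseteq> {1..rho U} \<Longrightarrow>
    restrict_conf (i_effect I s) U = f_effect I (restrict_conf s U)"
  by (cases I) (simp_all add: restrict_conf_iset freg_restrict_conf)

context
  fixes U :: program
  assumes wf: "wf_program U" and std: "standard_form U"
begin

lemma restrict_step:
  "instr_at U h I \<Longrightarrow> restrict_conf (i_effect I s) U = f_effect I (restrict_conf s U)"
  using restrict_conf_i_effect regs_le_rho[OF wf] instr_at_in_set by blast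

lemma jump_test_restrict:
  assumes "instr_at U h (Jump i j k)"
  shows "freg (restrict_conf s U) i = freg (restrict_conf s U) j \<longleftrightarrow> ireg s i = ireg s j"
  using regs_le_rho[OF wf instr_at_in_set[OF assms]] by (simp add: freg_restrict_conf)

text \<open>Restriction is a function of the stream, so in the halting cases the result is the
  required list at once; no uniqueness argument is involved.\<close>

lemma f_conv_of_i_conv:
  assumes "i_conv U s h t"
  shows "f_conv U (restrict_conf s U) h (restrict_conf t U)"
  using assms
proof induction
  case (i_conv_jump_end h i j k \<sigma>)
  then show ?case
    by (metis f_conv_jump_end jump_test_restrict compatible_restrict_conf wf std)
next
  case (i_conv_jump_next h i j k \<sigma> \<tau>)
  then show ?case
    by (metis f_conv_jump_next jump_test_restrict compatible_restrict_conf wf std)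
next
  case (i_conv_jump_halt h i j k \<sigma>)
  then show ?case
    by (metis f_conv_jump_halt jump_test_restrict compatible_restrict_conf wf std)
next
  case (i_conv_jump_to h i j k \<sigma> \<tau>)
  then show ?case
    by (metis f_conv_jump_to jump_test_restrict compatible_restrict_conf wf std)
next
  case (i_conv_step_end h I \<sigma>)
  then show ?case
    by (metis f_conv_step_end restrict_step compatible_restrict_conf wf std)
next
  case (i_conv_step_next h I \<sigma> \<tau>)
  then show ?case
    by (metis f_conv_step_next restrict_step compatible_restrict_conf wf std)
qed

lemma f_div_of_i_div:
  assumes "i_div U s h"
  shows "f_div U (restrict_conf s U) h"
  using assms
proof (coinduction arbitrary: s h)
  case f_div
  note compat = compatible_restrict_conf[OF wf std, of s]
  from f_div show ?case
  proof cases
    case (i_div_jump_next i j k)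
    then show ?thesis
      using compat jump_test_restrict[OF i_div_jump_next(1)] by (intro disjI1) auto
  next
    case (i_div_jump_to i j k)
    then show ?thesis
      using compat jump_test_restrict[OF i_div_jump_to(1)] by (intro disjI2 disjI1) auto
  next
    case (i_div_step_next I)
    \<comment> \<open>The next list must be exhibited as the restriction of a diverging stream;
      \<open>i_effect I s\<close> is one by \<open>restrict_step\<close>.\<close>
    then show ?thesis
      using compat restrict_step[OF i_div_step_next(1), of s]
      by (intro disjI2) (auto intro!: exI[of _ "i_effect I s"])
  qed
qed

end

text \<open>Every finite rule demands compatibility, which includes standard form. The last two
  parts conclude finite evaluations and therefore assume \<open>standard_form U\<close>; in the
  first two it comes with \<open>compatible\<close>.\<close>

theorem mainTheorem1:
  fixes U :: program and \<sigma> \<tau> :: fconf and \<sigma>s \<tau>s :: iconf and h :: nat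
  assumes "wf_program U"
    and "h \<in> {1..length U}"
  shows "(f_conv U \<sigma> h \<tau> \<and> compatible \<sigma> U \<and> included \<sigma> \<sigma>s \<and> included \<tau> \<tau>s
            \<longrightarrow> i_conv U \<sigma>s h \<tau>s)
       \<and> (f_div U \<sigma> h \<and> compatible \<sigma> U \<and> included \<sigma> \<sigma>s \<longrightarrow> i_div U \<sigma>s h)
       \<and> (standard_form U \<and> i_conv U \<sigma>s h \<tau>s
            \<longrightarrow> f_conv U (restrict_conf \<sigma>s U) h (restrict_conf \<tau>s U))
       \<and> (standard_form U \<and> i_div U \<sigma>s h \<longrightarrow> f_div U (restrict_conf \<sigma>s U) h)"
  by (intro conjI impI; elim conjE)
    (rule i_conv_of_f_conv i_div_of_f_div
      f_conv_of_i_conv[OF assms(1)] f_div_of_i_div[OF assms(1)]; assumption)+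

end
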